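(* Let $a$ and $b$ be positive integers with $\gcd(a,b)=1$, and let $\lambda\in\mathbb{C}$ with $\lambda\neq 0$, $\lambda^a\neq 1$ and $\lambda^b\neq 1$. Then $$ S_1^{(\lambda)}(a,b)=\frac{1}{(\lambda-1)^2}+\frac{a b\, \lambda^{a b-1}}{(\lambda^a-1)(\lambda^b-1)}-\frac{(\lambda^{a b}-1)\bigl((a+b)\lambda^{a+b}-a \lambda^a-b \lambda^b\bigr)}{\lambda(\lambda^a-1)^2(\lambda^b-1)^2}. $$
   Context: For coprime positive integers $a,b$, $\mathrm{NR}(a,b)$ denotes the (finite) set of all nonnegative integers $n$ that cannot be expressed in the form $n=ax+by$ with $x,y$ nonnegative integers. (Since $0$ is representable, all elements are positive.) For a nonnegative integer $m$ and $\lambda\neq 0$, $$S_m^{(\lambda)}(a,b):=\sum_{n\in \mathrm{NR}(a,b)}\lambda^{n-1}n^m.$$ *)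

theory Defs
  imports Complex_Main
begin

definition NR :: "nat \<Rightarrow> nat \<Rightarrow> nat set" where
  "NR a b = {n. \<not> (\<exists>x y :: nat. n = a * x + b * y)}"

text \<open>
  For coprime positive \<open>a\<close> and \<open>b\<close> the set \<open>NR a b\<close> is finite, so the sum below is
  the genuine one; and \<open>0\<close> is not in \<open>NR a b\<close>, so the subtraction in the exponent
  \<open>n - 1\<close> does not truncate.
\<close>

definition S :: "nat \<Rightarrow> complex \<Rightarrow> nat \<Rightarrow> nat \<Rightarrow> complex" where
  "S m l a b = (\<Sum>n\<in>NR a b. l ^ (n - 1) * of_nat n ^ m)"

end

(* Modulo a, every residue is b y for exactly one y < a, and n in that class is representable iff
   n \<ge> b y. Summing the resulting geometric progressions gives
     \<Sum>_{n \<in> NR a b} z^n = (z^{ab} - 1) / ((z^a - 1) (z^b - 1)) - 1 / (z - 1),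
   and the sum S 1 l a b is the derivative of this rational function at z = l. *)
theory Submission
  imports Defs "HOL-Number_Theory.Cong"
begin

text \<open>Coprimality allows cancelling \<open>b\<close> modulo \<open>a\<close>, which gives
  injectivity; an injective self-map of a finite set is onto.\<close>

lemma bij_betw_mult_mod:
  fixes a b :: nat
  assumes "a > 0" and "coprime a b"
  shows "bij_betw (\<lambda>y. b * y mod a) {..<a} {..<a}"
proof -
  have "inj_on (\<lambda>y. b * y mod a) {..<a}"
  proof (rule inj_onI)
    fix x y assume x: "x \<in> {..<a}" and y: "y \<in> {..<a}" and "b * x mod a = b * y mod a"
    then have "[b * x = b * y] (mod a)" by (simp add: cong_def)
    then have "[x = y] (mod a)"
      using assms by (simp add: cong_mult_lcancel_nat coprime_commute)
    then show "x = y" using x y by (simp add: cong_def)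
  qed
  moreover have "(\<lambda>y. b * y mod a) ` {..<a} \<subseteq> {..<a}" using assms by auto
  ultimately show ?thesis
    by (simp add: bij_betw_def endo_inj_surj)
qed

text \<open>The pair \<open>(y, j)\<close> names the \<open>j\<close>-th natural number, counted
  from 0, in the residue class of \<open>b * y\<close>. As
  \<open>b * y = b * y mod a + a * (b * y div a)\<close>, the bound on \<open>j\<close> selects
  exactly the members below \<open>b * y\<close>.\<close>

lemma bij_betw_NR:
  fixes a b :: nat
  assumes "a > 0" and "coprime a b"
  shows "bij_betw (\<lambda>(y, j). b * y mod a + a * j) (SIGMA y:{..<a}. {..<b * y div a}) (NR a b)"
proof -
  let ?r = "\<lambda>y. b * y mod a"
  note bij = bij_betw_mult_mod[OF assms]
  have mod_r: "(?r y + a * j) mod a = ?r y" for y j by simp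
  have "inj_on (\<lambda>(y, j). ?r y + a * j) (SIGMA y:{..<a}. {..<b * y div a})"
  proof (rule inj_onI, clarsimp)
    fix y j y' j' assume "y < a" "y' < a" and eq: "?r y + a * j = ?r y' + a * j'"
    have "?r y = ?r y'" using arg_cong[OF eq, of "\<lambda>n. n mod a"] unfolding mod_r .
    then have "y = y'"
      using inj_onD[OF bij_betw_imp_inj_on[OF bij]] \<open>y < a\<close> \<open>y' < a\<close> by blast
    then show "y = y' \<and> j = j'" using eq \<open>a > 0\<close> by simp
  qed
  moreover have "?r y + a * j \<in> NR a b" if "y < a" "j < b * y div a" for y j
    unfolding NR_def
  proof clarsimp
    fix u v assume eq: "?r y + a * j = a * u + b * v"
    \<comment> \<open>Injectivity of \<open>?r\<close> is known only below \<open>a\<close>, so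
      \<open>v\<close> is first reduced. Then \<open>v mod a = y\<close> gives
      \<open>y \<le> v\<close>, so any representation in this class is at least
      \<open>b * y\<close>.\<close>
    have "?r y = ?r (v mod a)"
      using arg_cong[OF eq, of "\<lambda>n. n mod a"] by (simp add: mod_mult_right_eq)
    moreover have "v mod a < a" using \<open>a > 0\<close> by simp
    ultimately have "v mod a = y"
      using bij \<open>y < a\<close> unfolding bij_betw_def inj_on_def by (metis lessThan_iff)
    then have "y \<le> v" by auto
    then have "b * y \<le> ?r y + a * j" using eq by (simp add: trans_le_add2)
    moreover have "a * Suc j \<le> a * (b * y div a)" using that by (intro mult_le_mono2) simp
    then have "?r y + a * j < b * y"
      using \<open>a > 0\<close> mod_mult_div_eq[of "b * y" a] unfolding mult_Suc_right by linarith
    ultimately show False by simp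
  qed
  moreover have "n \<in> (\<lambda>(y, j). ?r y + a * j) ` (SIGMA y:{..<a}. {..<b * y div a})"
    if n: "n \<in> NR a b" for n
  proof -
    have "n mod a \<in> ?r ` {..<a}"
      using bij \<open>a > 0\<close> by (simp add: bij_betw_def)
    then obtain y where y: "y < a" "n mod a = ?r y" by auto
    have n_eq: "n = ?r y + a * (n div a)" using y(2) mod_mult_div_eq[of n a] by simp
    have "n div a < b * y div a"
    proof (rule ccontr)
      assume "\<not> n div a < b * y div a"
      \<comment> \<open>Here \<open>n\<close> lies \<open>k\<close> steps of length \<open>a\<close>
        above \<open>b * y\<close>, so \<open>k\<close> and \<open>y\<close> are the coefficients of
        a representation of \<open>n\<close>.\<close>
      then obtain k where k: "n div a = b * y div a + k"
        by (metis le_add_diff_inverse not_less)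
      have "n = a * k + b * y"
        using n_eq mod_mult_div_eq[of "b * y" a] unfolding k by (simp add: distrib_left)
      then show False using n unfolding NR_def by blast
    qed
    then show ?thesis using y(1) n_eq by force
  qed
  ultimately show ?thesis unfolding bij_betw_def by auto
qed

lemma sum_power_NR:
  fixes a b :: nat and z :: "'a :: field"
  assumes "a > 0" and "coprime a b" and za: "z ^ a \<noteq> 1" and zb: "z ^ b \<noteq> 1"
  shows "(\<Sum>n\<in>NR a b. z ^ n) = (z ^ (a * b) - 1) / ((z ^ a - 1) * (z ^ b - 1)) - 1 / (z - 1)"
proof -
  have z: "z \<noteq> 1" using za by auto
  have progression: "(\<Sum>j<b * y div a. z ^ (b * y mod a + a * j)) =
      ((z ^ b) ^ y - z ^ (b * y mod a)) / (z ^ a - 1)" for y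
  proof -
    \<comment> \<open>Division with remainder of \<open>b * y\<close> by \<open>a\<close>: the
      geometric sum ends just before the term \<open>z ^ (b * y)\<close>.\<close>
    have "(z ^ b) ^ y = z ^ (b * y mod a) * (z ^ a) ^ (b * y div a)"
      by (simp flip: power_mult power_add)
    then show ?thesis
      using za by (simp add: power_add power_mult geometric_sum right_diff_distrib
          flip: sum_distrib_left)
  qed
  have "(\<Sum>n\<in>NR a b. z ^ n) =
      (\<Sum>(y, j)\<in>(SIGMA y:{..<a}. {..<b * y div a}). z ^ (b * y mod a + a * j))"
    using sum.reindex_bij_betw[OF bij_betw_NR[OF assms(1,2)], of "\<lambda>n. z ^ n"]
    by (simp add: case_prod_unfold)
  also have "\<dots> = (\<Sum>y<a. ((z ^ b) ^ y - z ^ (b * y mod a)) / (z ^ a - 1))"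
    by (simp add: progression flip: sum.Sigma)
  also have "\<dots> = ((\<Sum>y<a. (z ^ b) ^ y) - (\<Sum>y<a. z ^ (b * y mod a))) / (z ^ a - 1)"
    by (simp add: sum_subtractf flip: sum_divide_distrib)
  \<comment> \<open>The residues \<open>b * y mod a\<close> are a permutation of
    \<open>{..<a}\<close>, so \<open>b\<close> drops out of this sum.\<close>
  also have "(\<Sum>y<a. z ^ (b * y mod a)) = (\<Sum>y<a. z ^ y)"
    using sum.reindex_bij_betw[OF bij_betw_mult_mod[OF assms(1,2)], of "\<lambda>n. z ^ n"] .
  also have "(\<Sum>y<a. (z ^ b) ^ y) = (z ^ (a * b) - 1) / (z ^ b - 1)"
    using zb geometric_sum[of "z ^ b" a] by (simp add: mult.commute flip: power_mult)
  also have "(\<Sum>y<a. z ^ y) = (z ^ a - 1) / (z - 1)"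
    using z by (simp add: geometric_sum)
  finally show ?thesis
    using za diff_divide_distrib[of "(z ^ (a * b) - 1) / (z ^ b - 1)" "(z ^ a - 1) / (z - 1)" "z ^ a - 1"]
    by (simp add: mult.commute)
qed

theorem theorem1:
  fixes a b :: nat and l :: complex
  assumes "a > 0" and "b > 0" and "gcd a b = 1"
    and "l \<noteq> 0" and "l ^ a \<noteq> 1" and "l ^ b \<noteq> 1"
  shows "S 1 l a b =
      1 / (l - 1)\<^sup>2
    + of_nat a * of_nat b * l ^ (a * b - 1) / ((l ^ a - 1) * (l ^ b - 1))
    - (l ^ (a * b) - 1) * (of_nat (a + b) * l ^ (a + b) - of_nat a * l ^ a - of_nat b * l ^ b)
        / (l * (l ^ a - 1)\<^sup>2 * (l ^ b - 1)\<^sup>2)"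
proof -
  let ?A = "l ^ a - 1" and ?B = "l ^ b - 1" and ?C = "l ^ (a * b) - 1"
  let ?A' = "of_nat a * l ^ (a - 1)" and ?B' = "of_nat b * l ^ (b - 1)"
    and ?C' = "of_nat (a * b) * l ^ (a * b - 1)"
  let ?f = "\<lambda>z. (z ^ (a * b) - 1) / ((z ^ a - 1) * (z ^ b - 1)) - 1 / (z - 1)"
  have cop: "coprime a b" using assms(3) by (simp add: coprime_iff_gcd_eq_1)
  have l1: "l - 1 \<noteq> 0" and A: "?A \<noteq> 0" and B: "?B \<noteq> 0" using assms by auto
  \<comment> \<open>Differentiating the closed form needs it on a whole neighbourhood of
    \<open>l\<close>, not just at \<open>l\<close>; by continuity its denominators stay nonzero
    there.\<close>
  have ne: "eventually (\<lambda>z. z ^ k \<noteq> 1) (nhds l)" if "l ^ k \<noteq> 1" for k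
    using that by (intro tendsto_imp_eventually_ne[of _ "l ^ k"] tendsto_power filterlim_ident)
  have ev: "eventually (\<lambda>z. (\<Sum>n\<in>NR a b. z ^ n) = ?f z) (nhds l)"
    using ne[OF assms(5)] ne[OF assms(6)]
    by eventually_elim (rule sum_power_NR[OF assms(1) cop])
  \<comment> \<open>Termwise, the derivative of \<open>z ^ n\<close> at \<open>l\<close> is
    \<open>of_nat n * l ^ (n - 1)\<close>, the summand of \<open>S 1 l a b\<close>.\<close>
  have "((\<lambda>z. \<Sum>n\<in>NR a b. z ^ n) has_field_derivative S 1 l a b) (at l)"
    unfolding S_def by (auto intro!: derivative_eq_intros simp: mult.commute)
  then have deriv_S: "(?f has_field_derivative S 1 l a b) (at l)"
    using DERIV_cong_ev[OF refl ev refl] by simp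
  have deriv: "((\<lambda>z. z ^ k - 1) has_field_derivative of_nat k * l ^ (k - 1)) (at l)" for k
    by (auto intro!: derivative_eq_intros)
  have AB: "?A * ?B \<noteq> 0" using A B by simp
  have "(?f has_field_derivative
      (?C' * (?A * ?B) - ?C * (?A' * ?B + ?A * ?B')) / (?A * ?B)\<^sup>2 + 1 / (l - 1)\<^sup>2) (at l)"
    \<comment> \<open>Quotient rule on both fractions; the linear denominator \<open>z - 1\<close>
      is the case \<open>k = 1\<close> of \<open>deriv\<close>.\<close>
    by (rule DERIV_cong[OF DERIV_diff[OF
          DERIV_divide[OF deriv deriv[THEN DERIV_mult', OF deriv] AB]
          DERIV_divide[OF DERIV_const deriv[of 1, unfolded power_one_right] l1]]])
      (simp add: power2_eq_square add.commute)
  with deriv_S have "S 1 l a b =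
      (?C' * (?A * ?B) - ?C * (?A' * ?B + ?A * ?B')) / (?A * ?B)\<^sup>2 + 1 / (l - 1)\<^sup>2"
    by (rule DERIV_unique)
  also have "\<dots> = 1 / (l - 1)\<^sup>2 + ?C' / (?A * ?B) - ?C * (?A' * ?B + ?A * ?B') / (?A * ?B)\<^sup>2"
    using A B by (simp add: diff_divide_distrib power2_eq_square)
  \<comment> \<open>Expanding by \<open>l\<close> raises the exponents \<open>a - 1\<close> and
    \<open>b - 1\<close> to \<open>a\<close> and \<open>b\<close>, and yields the factor
    \<open>l\<close> in the stated denominator.\<close>
  also have "?C * (?A' * ?B + ?A * ?B') / (?A * ?B)\<^sup>2 =
      ?C * (l * (?A' * ?B + ?A * ?B')) / (l * ?A\<^sup>2 * ?B\<^sup>2)"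
    using assms(4) by (simp add: power_mult_distrib)
  also have "l * (?A' * ?B + ?A * ?B') =
      of_nat (a + b) * l ^ (a + b) - of_nat a * l ^ a - of_nat b * l ^ b"
  proof -
    \<comment> \<open>Positivity of \<open>a\<close> and \<open>b\<close> keeps the natural
      subtraction from truncating.\<close>
    have pow: "l * l ^ (a - 1) = l ^ a" "l * l ^ (b - 1) = l ^ b"
      using assms(1,2) by (simp_all flip: power_Suc)
    have "l * (?A' * ?B + ?A * ?B') =
        of_nat a * (l * l ^ (a - 1)) * ?B + ?A * (of_nat b * (l * l ^ (b - 1)))"
      by (simp only: distrib_left mult_ac)
    also have "\<dots> = of_nat a * l ^ a * ?B + ?A * (of_nat b * l ^ b)"
      unfolding pow ..
    also have "\<dots> = of_nat (a + b) * l ^ (a + b) - of_nat a * l ^ a - of_nat b * l ^ b"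
      by (simp add: algebra_simps power_add)
    finally show ?thesis .
  qed
  finally show ?thesis by simp
qed

end
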